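(* Let $\gamma : I\to\mathbb{R}^3$ be a regular space curve parametrized by arc length $s$, with nowhere vanishing curvature and unit tangent $T$. Let $c$ be a real constant with $c-s>0$ for all $s\in I$, and let $\widetilde\gamma=\gamma+(c-s)T$ be the involute of $\gamma$, so that $\gamma$ is the evolute of $\widetilde\gamma$. Then the spherical image of the tangent indicatrix of $\widetilde\gamma$ is a circle on the unit sphere if and only if the evolute $\gamma$ of $\widetilde\gamma$ is a generalized helix.
   Context: A curve $\gamma$ is called an evolute of $\widetilde\gamma$, and $\widetilde\gamma$ an involute of $\gamma$, if their tangent vectors are orthogonal at corresponding points, with $\widetilde\gamma=\gamma+\lambda T$; here $\lambda=c-s$. Both curves are assumed regular. The spherical image of the tangent indicatrix of $\widetilde\gamma$ is the curve traced on the unit sphere by the unit tangent vector $\widetilde T$ of $\widetilde\gamma$. A curve with curvature $\kappa>0$ and torsion $\tau$ is a generalized helix if $\tau/\kappa$ is constant (the value $0$ is allowed).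
   Formalization: "A circle on the unit sphere" is proved as a non-constant arc of a great circle; for small circles the "only if" fails, e.g. for the curve with curvature 1 and torsion ms/√(1−m²s²), whose involute has its tangent indicatrix on a small circle although τ/κ is not constant. *)

theory Defs
  imports "HOL-Analysis.Analysis"
begin

(* Derivatives are taken within the parameter interval I, so that they are one-sided at
   endpoints belonging to I and ordinary two-sided derivatives in the interior. *)
definition vderiv :: "real set \<Rightarrow> (real \<Rightarrow> 'a::real_normed_vector) \<Rightarrow> real \<Rightarrow> 'a" where
  "vderiv I f s = vector_derivative f (at s within I)"

definition C_k_on :: "nat \<Rightarrow> real set \<Rightarrow> (real \<Rightarrow> 'a::real_normed_vector) \<Rightarrow> bool" where
  "C_k_on k I f \<longleftrightarrow>
     (\<forall>j<k. \<forall>s\<in>I. (vderiv I ^^ j) f differentiable (at s within I)) \<and>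
     continuous_on I ((vderiv I ^^ k) f)"

(* C^3 is what the torsion of a curve needs; it includes the smooth case. *)
definition unit_speed_curve :: "real set \<Rightarrow> (real \<Rightarrow> real^3) \<Rightarrow> bool" where
  "unit_speed_curve I \<gamma> \<longleftrightarrow> C_k_on 3 I \<gamma> \<and> (\<forall>s\<in>I. norm (vderiv I \<gamma> s) = 1)"

(* sgn v = v / norm v, so this is the unit tangent for an arbitrary regular parametrization. *)
definition unit_tangent :: "real set \<Rightarrow> (real \<Rightarrow> real^3) \<Rightarrow> real \<Rightarrow> real^3" where
  "unit_tangent I \<gamma> s = sgn (vderiv I \<gamma> s)"

(* The following Frenet data are meant for curves parametrized by arc length:
   T' = curvature N,  N = T' / norm T',  B = T x N,  B' = - torsion N. *)
definition curvature :: "real set \<Rightarrow> (real \<Rightarrow> real^3) \<Rightarrow> real \<Rightarrow> real" where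
  "curvature I \<gamma> s = norm (vderiv I (unit_tangent I \<gamma>) s)"

definition principal_normal :: "real set \<Rightarrow> (real \<Rightarrow> real^3) \<Rightarrow> real \<Rightarrow> real^3" where
  "principal_normal I \<gamma> s = sgn (vderiv I (unit_tangent I \<gamma>) s)"

definition binormal :: "real set \<Rightarrow> (real \<Rightarrow> real^3) \<Rightarrow> real \<Rightarrow> real^3" where
  "binormal I \<gamma> s = cross3 (unit_tangent I \<gamma> s) (principal_normal I \<gamma> s)"

definition torsion :: "real set \<Rightarrow> (real \<Rightarrow> real^3) \<Rightarrow> real \<Rightarrow> real" where
  "torsion I \<gamma> s = - (vderiv I (binormal I \<gamma>) s \<bullet> principal_normal I \<gamma> s)"

definition generalized_helix :: "real set \<Rightarrow> (real \<Rightarrow> real^3) \<Rightarrow> bool" where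
  "generalized_helix I \<gamma> \<longleftrightarrow>
     (\<forall>s\<in>I. curvature I \<gamma> s > 0) \<and>
     (\<exists>k. \<forall>s\<in>I. torsion I \<gamma> s / curvature I \<gamma> s = k)"

definition involute :: "real set \<Rightarrow> real \<Rightarrow> (real \<Rightarrow> real^3) \<Rightarrow> real \<Rightarrow> real^3" where
  "involute I c \<gamma> s = \<gamma> s + (c - s) *\<^sub>R unit_tangent I \<gamma> s"

(* "Circle on the unit sphere" is read intrinsically, as a great circle.  Small circles must be
   excluded: the unit tangent of the involute is the principal normal N of the evolute, and N
   runs on a small circle exactly for the slant helices that are not generalized helices, such as
   the curve with curvature 1 and torsion m s / sqrt (1 - (m s)^2). *)
definition great_circle :: "(real^3) set \<Rightarrow> bool" where
  "great_circle C \<longleftrightarrow> (\<exists>a. a \<noteq> 0 \<and> C = {x \<in> sphere 0 1. a \<bullet> x = 0})"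

(* As I is an arbitrary interval, the curve need not run through the whole circle; being an arc
   of a circle means being a non-constant curve lying on it. *)
definition traces_great_circle :: "real set \<Rightarrow> (real \<Rightarrow> real^3) \<Rightarrow> bool" where
  "traces_great_circle I \<alpha> \<longleftrightarrow>
     continuous_on I \<alpha> \<and> \<not> \<alpha> constant_on I \<and> (\<exists>C. great_circle C \<and> \<alpha> ` I \<subseteq> C)"

end

theory Submission
  imports Defs
begin

unbundle cross3_syntax

text \<open>
  The derivative of the involute is \<open>(c - s) \<kappa> N\<close>, because the derivative of \<open>c - s\<close> cancels the
  velocity \<open>T\<close> of the evolute. Since \<open>(c - s) \<kappa> > 0\<close>, the unit tangent of the involute is exactly
  the principal normal \<open>N\<close> of the evolute (\<open>unit_tangent_involute\<close>). The question is therefore when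
  \<open>N\<close> runs on a great circle, that is, when some fixed vector \<open>a \<noteq> 0\<close> satisfies \<open>a \<bullet> N = 0\<close>
  throughout; and this is decided by the Frenet equations.

  If \<open>\<tau> = k \<kappa>\<close>, then \<open>a = k T + B\<close> has derivative \<open>(k \<kappa> - \<tau>) N = 0\<close>, so it is a fixed vector, and
  it is orthogonal to \<open>N\<close>: this is the axis of the helix (\<open>helix_axis\<close>). Moreover \<open>N\<close> is not
  constant, since \<open>N' \<bullet> T = - \<kappa> \<noteq> 0\<close>.

  Conversely, if \<open>a\<close> is fixed and orthogonal to \<open>N\<close>, then \<open>a \<bullet> T\<close> and \<open>a \<bullet> B\<close> have derivatives
  proportional to \<open>a \<bullet> N = 0\<close> and are constants \<open>p\<close> and \<open>q\<close>. Differentiating \<open>a \<bullet> N = 0\<close> gives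
  \<open>q \<tau> = p \<kappa>\<close>. Here \<open>q \<noteq> 0\<close>, since otherwise \<open>p = 0\<close> too, as
  \<open>\<kappa> \<noteq> 0\<close>, and \<open>a\<close> would be orthogonal to the whole frame; so \<open>\<tau> / \<kappa> = p / q\<close>
  (\<open>normal_on_great_circle_imp_helix\<close>).
\<close>

section \<open>Derivatives within an interval\<close>

text \<open>Every point of an interval with interior points, end points included, is a limit point of it,
  so one-sided derivatives are unique.\<close>

lemma vderiv_eqI:
  assumes "is_interval I" "interior I \<noteq> {}" "s \<in> I" "(f has_vector_derivative d) (at s within I)"
  shows "vderiv I f s = d"
proof -
  have "I \<noteq> {x}" for x
    using assms(2) by auto
  then have "s islimpt I"
    using assms(1,3) by (intro connected_imp_perfect) (auto simp: is_interval_connected)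
  then show ?thesis
    unfolding vderiv_def using assms(4)
    by (intro vector_derivative_within) (simp_all add: trivial_limit_within)
qed

lemma has_vector_derivative_vderiv:
  assumes "f differentiable (at s within I)"
  shows "(f has_vector_derivative vderiv I f s) (at s within I)"
  using assms by (simp add: vderiv_def vector_derivative_works)

lemma has_vector_derivative_inner:
  fixes f g :: "real \<Rightarrow> 'a::real_inner"
  assumes "(f has_vector_derivative f') (at s within I)"
    and "(g has_vector_derivative g') (at s within I)"
  shows "((\<lambda>x. f x \<bullet> g x) has_vector_derivative (f s \<bullet> g' + f' \<bullet> g s)) (at s within I)"
  by (rule bounded_bilinear.has_vector_derivative[OF bounded_bilinear_inner assms])

lemma has_vector_derivative_cross3:
  fixes f g :: "real \<Rightarrow> real^3"
  assumes "(f has_vector_derivative f') (at s within I)"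
    and "(g has_vector_derivative g') (at s within I)"
  shows "((\<lambda>x. f x \<times> g x) has_vector_derivative (f s \<times> g' + f' \<times> g s)) (at s within I)"
  using bounded_bilinear.has_vector_derivative[OF _ assms] bilinear_cross
  by (simp add: bilinear_conv_bounded_bilinear)

lemma differentiable_sgn:
  fixes f :: "real \<Rightarrow> 'a::real_inner"
  assumes "f differentiable (at s within I)" "f s \<noteq> 0"
  shows "(\<lambda>x. sgn (f x)) differentiable (at s within I)"
proof -
  have "(\<lambda>x. norm (f x)) differentiable (at s within I)"
    using differentiable_compose[of norm f s I] assms by simp
  then show ?thesis
    unfolding sgn_div_norm using assms
    by (intro differentiable_scaleR differentiable_inverse) auto
qed

text \<open>The product rule for a pair of vector fields with constant inner product; it yields the
  coordinates of the derivatives of the Frenet frame with respect to the frame itself.\<close>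

lemma inner_constant_imp_inner_deriv:
  fixes f g :: "real \<Rightarrow> 'a::real_inner"
  assumes "is_interval I" "interior I \<noteq> {}" "s \<in> I"
    and "(f has_vector_derivative f') (at s within I)"
    and "(g has_vector_derivative g') (at s within I)"
    and const: "\<And>x. x \<in> I \<Longrightarrow> f x \<bullet> g x = C"
  shows "f' \<bullet> g s = - (f s \<bullet> g')"
proof -
  have "((\<lambda>x. f x \<bullet> g x) has_vector_derivative 0) (at s within I)"
    by (rule has_vector_derivative_transform[OF \<open>s \<in> I\<close> const]) auto
  then have "f s \<bullet> g' + f' \<bullet> g s = 0"
    using vderiv_eqI[OF assms(1-3)] has_vector_derivative_inner[OF assms(4,5)] by metis
  then show ?thesis
    by simp
qed

text \<open>A vector orthogonal to \<open>t\<close>, \<open>n\<close> and \<open>t \<times> n\<close> has zero inner and zero cross product with the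
  unit vector \<open>t \<times> n\<close>, and is therefore zero; applied to the difference of the two sides.\<close>

lemma orthonormal_frame_expansion:
  fixes t n v :: "real^3"
  assumes "norm t = 1" "norm n = 1" "t \<bullet> n = 0"
  shows "v = (v \<bullet> t) *\<^sub>R t + (v \<bullet> n) *\<^sub>R n + (v \<bullet> (t \<times> n)) *\<^sub>R (t \<times> n)"
proof -
  define b where "b = t \<times> n"
  have "norm b = 1"
    using norm_cross_dot[of t n] assms by (simp add: b_def norm_eq_1 power2_norm_eq_inner)
  define w where "w = v - ((v \<bullet> t) *\<^sub>R t + (v \<bullet> n) *\<^sub>R n + (v \<bullet> b) *\<^sub>R b)"
  have unit: "t \<bullet> t = 1" "n \<bullet> n = 1" "b \<bullet> b = 1"
    using assms \<open>norm b = 1\<close> by (simp_all add: dot_square_norm)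
  have orth: "t \<bullet> n = 0" "n \<bullet> t = 0" "b \<bullet> t = 0" "t \<bullet> b = 0" "b \<bullet> n = 0" "n \<bullet> b = 0"
    using assms(3) by (simp_all add: b_def dot_cross_self inner_commute)
  have w: "w \<bullet> t = 0" "w \<bullet> n = 0" "w \<bullet> b = 0"
    by (simp_all add: w_def inner_diff_left inner_add_left unit orth)
  then have "w \<times> b = 0"
    by (simp add: b_def Lagrange)
  with w(3) \<open>norm b = 1\<close> have "w = 0"
    using norm_and_cross_eq_0[of w b] by auto
  then show ?thesis
    by (simp add: w_def b_def)
qed

section \<open>The Frenet equations\<close>

locale frenet_curve =
  fixes I :: "real set" and \<gamma> :: "real \<Rightarrow> real^3"
  assumes interval: "is_interval I" "interior I \<noteq> {}"
    and unit_speed: "unit_speed_curve I \<gamma>"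
    and curvature_nonzero: "\<And>s. s \<in> I \<Longrightarrow> curvature I \<gamma> s \<noteq> 0"
begin

abbreviation "T \<equiv> unit_tangent I \<gamma>"
abbreviation "N \<equiv> principal_normal I \<gamma>"
abbreviation "B \<equiv> binormal I \<gamma>"
abbreviation "\<kappa> \<equiv> curvature I \<gamma>"
abbreviation "\<tau> \<equiv> torsion I \<gamma>"

lemma curvature_pos: "s \<in> I \<Longrightarrow> \<kappa> s > 0"
  using curvature_nonzero[of s] by (simp add: curvature_def)

lemma unit_tangent_eq: "s \<in> I \<Longrightarrow> T s = vderiv I \<gamma> s"
  using unit_speed by (simp add: unit_tangent_def unit_speed_curve_def sgn_div_norm)

lemma curve_differentiable:
  assumes "s \<in> I"
  shows "\<gamma> differentiable (at s within I)"
    and "vderiv I \<gamma> differentiable (at s within I)"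
    and "vderiv I (vderiv I \<gamma>) differentiable (at s within I)"
proof -
  have *: "(vderiv I ^^ j) \<gamma> differentiable (at s within I)" if "j < 3" for j
    using unit_speed that assms by (auto simp: unit_speed_curve_def C_k_on_def)
  show "\<gamma> differentiable (at s within I)" "vderiv I \<gamma> differentiable (at s within I)"
    "vderiv I (vderiv I \<gamma>) differentiable (at s within I)"
    using *[of 0] *[of 1] *[of 2] by (simp_all add: numeral_2_eq_2)
qed

lemma curve_deriv: "s \<in> I \<Longrightarrow> (\<gamma> has_vector_derivative T s) (at s within I)"
  using has_vector_derivative_vderiv[OF curve_differentiable(1)] by (simp add: unit_tangent_eq)

lemma unit_tangent_has_vderiv:
  assumes "s \<in> I"
  shows "(T has_vector_derivative vderiv I (vderiv I \<gamma>) s) (at s within I)"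
  by (rule has_vector_derivative_transform[OF assms unit_tangent_eq])
     (auto intro: has_vector_derivative_vderiv curve_differentiable assms)

lemma vderiv_unit_tangent: "s \<in> I \<Longrightarrow> vderiv I T s = vderiv I (vderiv I \<gamma>) s"
  by (rule vderiv_eqI[OF interval _ unit_tangent_has_vderiv])

lemma frenet_tangent:
  assumes "s \<in> I"
  shows "(T has_vector_derivative \<kappa> s *\<^sub>R N s) (at s within I)"
proof -
  have "\<kappa> s *\<^sub>R N s = vderiv I T s"
    using curvature_pos[OF assms] by (simp add: curvature_def principal_normal_def sgn_div_norm)
  then show ?thesis
    using unit_tangent_has_vderiv[OF assms] vderiv_unit_tangent[OF assms] by simp
qed

lemma norm_frame [simp]:
  assumes "s \<in> I"
  shows "norm (T s) = 1" "norm (N s) = 1"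
  using assms unit_speed curvature_pos[OF assms]
  by (auto simp: unit_tangent_eq unit_speed_curve_def principal_normal_def norm_sgn curvature_def)

lemma inner_frame_self:
  assumes "s \<in> I"
  shows "T s \<bullet> T s = 1" "N s \<bullet> N s = 1"
  using assms by (simp_all add: dot_square_norm)

lemma tangent_orthogonal_normal:
  assumes "s \<in> I"
  shows "T s \<bullet> N s = 0"
proof -
  have "(\<kappa> s *\<^sub>R N s) \<bullet> T s = - (T s \<bullet> (\<kappa> s *\<^sub>R N s))"
    by (rule inner_constant_imp_inner_deriv[OF interval assms])
       (auto intro: frenet_tangent assms inner_frame_self)
  then show ?thesis
    using curvature_pos[OF assms] by (simp add: inner_commute)
qed

lemma binormal_orthogonal: "B s \<bullet> T s = 0" "B s \<bullet> N s = 0"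
  by (simp_all add: binormal_def dot_cross_self)

lemma normal_orthogonal: "s \<in> I \<Longrightarrow> N s \<bullet> T s = 0" "N s \<bullet> B s = 0"
  using tangent_orthogonal_normal[of s] binormal_orthogonal(2)[of s]
  by (simp_all add: inner_commute)

lemma inner_binormal_self: "s \<in> I \<Longrightarrow> B s \<bullet> B s = 1"
  using norm_cross_dot[of "T s" "N s"] tangent_orthogonal_normal[of s]
  by (simp add: binormal_def flip: power2_norm_eq_inner)

lemma frame_expansion:
  "s \<in> I \<Longrightarrow> v = (v \<bullet> T s) *\<^sub>R T s + (v \<bullet> N s) *\<^sub>R N s + (v \<bullet> B s) *\<^sub>R B s"
  unfolding binormal_def
  by (intro orthonormal_frame_expansion norm_frame tangent_orthogonal_normal)

lemma normal_differentiable: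
  assumes "s \<in> I"
  shows "(N has_vector_derivative vderiv I N s) (at s within I)"
proof -
  let ?A = "\<lambda>x. sgn (vderiv I (vderiv I \<gamma>) x)"
  have "vderiv I (vderiv I \<gamma>) s \<noteq> 0"
    using curvature_pos[OF assms] vderiv_unit_tangent[OF assms] by (auto simp: curvature_def)
  then have "?A differentiable (at s within I)"
    using curve_differentiable(3)[OF assms] by (rule differentiable_sgn[rotated])
  then have "(?A has_vector_derivative vderiv I ?A s) (at s within I)"
    by (rule has_vector_derivative_vderiv)
  then have "(N has_vector_derivative vderiv I ?A s) (at s within I)"
    using vderiv_unit_tangent
    by (intro has_vector_derivative_transform[of s I N ?A] assms) (auto simp: principal_normal_def)
  then show ?thesis
    using vderiv_eqI[OF interval assms] by metis
qed

text \<open>The product rule for \<open>B = T \<times> N\<close> loses its term \<open>T' \<times> N\<close>, as \<open>T'\<close> is parallel to \<open>N\<close>. What is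
  left, \<open>T \<times> N'\<close>, is orthogonal to \<open>T\<close>; and it is orthogonal to \<open>B\<close> because \<open>B\<close> has constant
  length. Its only coordinate is the one along \<open>N\<close>, which is \<open>- \<tau>\<close> by definition.\<close>

lemma frenet_binormal:
  assumes "s \<in> I"
  shows "(B has_vector_derivative - \<tau> s *\<^sub>R N s) (at s within I)"
proof -
  have "((\<lambda>x. T x \<times> N x) has_vector_derivative T s \<times> vderiv I N s + (\<kappa> s *\<^sub>R N s) \<times> N s)
      (at s within I)"
    by (intro has_vector_derivative_cross3 frenet_tangent normal_differentiable assms)
  then have B: "(B has_vector_derivative T s \<times> vderiv I N s) (at s within I)"
    by (simp add: binormal_def[abs_def] cross_mult_left)
  then have eq: "vderiv I B s = T s \<times> vderiv I N s"
    by (rule vderiv_eqI[OF interval assms])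
  have "vderiv I B s \<bullet> B s = - (B s \<bullet> vderiv I B s)"
    using B unfolding eq[symmetric]
    by (intro inner_constant_imp_inner_deriv[OF interval assms]) (auto intro: inner_binormal_self)
  then have "vderiv I B s \<bullet> B s = 0"
    by (simp add: inner_commute)
  moreover have "vderiv I B s \<bullet> T s = 0"
    by (simp add: eq dot_cross_self)
  ultimately have "vderiv I B s = - \<tau> s *\<^sub>R N s"
    using frame_expansion[OF assms, of "vderiv I B s"] by (simp add: torsion_def)
  then show ?thesis
    using B eq by simp
qed

lemma frenet_normal:
  assumes "s \<in> I"
  shows "(N has_vector_derivative \<tau> s *\<^sub>R B s - \<kappa> s *\<^sub>R T s) (at s within I)"
proof -
  note N = normal_differentiable[OF assms]
  have "vderiv I N s \<bullet> T s = - (N s \<bullet> (\<kappa> s *\<^sub>R N s))"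
    by (rule inner_constant_imp_inner_deriv[OF interval assms N frenet_tangent[OF assms]])
       (rule normal_orthogonal)
  moreover have "vderiv I N s \<bullet> N s = - (N s \<bullet> vderiv I N s)"
    by (rule inner_constant_imp_inner_deriv[OF interval assms N N]) (rule inner_frame_self)
  moreover have "vderiv I N s \<bullet> B s = - (N s \<bullet> (- \<tau> s *\<^sub>R N s))"
    by (rule inner_constant_imp_inner_deriv[OF interval assms N frenet_binormal[OF assms]])
       (rule normal_orthogonal)
  ultimately have "vderiv I N s = \<tau> s *\<^sub>R B s - \<kappa> s *\<^sub>R T s"
    using frame_expansion[OF assms, of "vderiv I N s"]
    by (simp add: inner_frame_self[OF assms] inner_commute)
  then show ?thesis
    using N by simp
qed

section \<open>The unit tangent of the involute on a great circle\<close>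

lemma unit_tangent_involute:
  assumes "s \<in> I" "c - s > 0"
  shows "unit_tangent I (involute I c \<gamma>) s = N s"
proof -
  have "((\<lambda>x. c - x) has_field_derivative - 1) (at s within I)"
    by (auto intro!: derivative_eq_intros)
  then have "((\<lambda>x. \<gamma> x + (c - x) *\<^sub>R T x) has_vector_derivative
      T s + ((c - s) *\<^sub>R (\<kappa> s *\<^sub>R N s) + (- 1) *\<^sub>R T s)) (at s within I)"
    by (intro has_vector_derivative_add has_vector_derivative_scaleR curve_deriv frenet_tangent
        assms)
  then have "(involute I c \<gamma> has_vector_derivative ((c - s) * \<kappa> s) *\<^sub>R N s) (at s within I)"
    by (simp add: involute_def[abs_def])
  then have "vderiv I (involute I c \<gamma>) s = ((c - s) * \<kappa> s) *\<^sub>R N s"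
    by (rule vderiv_eqI[OF interval assms(1)])
  moreover have "sgn ((c - s) * \<kappa> s) = 1"
    using assms curvature_pos by simp
  moreover have "sgn (N s) = N s"
    using assms(1) by (simp add: sgn_div_norm)
  ultimately show ?thesis
    by (simp only: unit_tangent_def sgn_scaleR scaleR_one)
qed

lemma convex_interval: "convex I"
  using interval(1) by (simp add: is_interval_convex)

lemma normal_continuous: "continuous_on I N"
  unfolding continuous_on_eq_continuous_within
  by (intro ballI has_vector_derivative_continuous[OF frenet_normal])

lemma normal_not_constant: "\<not> N constant_on I"
proof
  assume "N constant_on I"
  then obtain n where n: "\<And>x. x \<in> I \<Longrightarrow> N x = n"
    by (auto simp: constant_on_def)
  obtain s where s: "s \<in> I"
    using interval(2) interior_subset by blast
  have "(N has_vector_derivative 0) (at s within I)"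
    by (rule has_vector_derivative_transform[OF s n]) auto
  then have "\<tau> s *\<^sub>R B s - \<kappa> s *\<^sub>R T s = 0"
    using vderiv_eqI[OF interval s] frenet_normal[OF s] by metis
  then have "(\<tau> s *\<^sub>R B s - \<kappa> s *\<^sub>R T s) \<bullet> T s = 0"
    by simp
  then show False
    using curvature_pos[OF s]
    by (simp add: inner_diff_left binormal_orthogonal inner_frame_self[OF s])
qed

text \<open>The axis is the constant value of \<open>k T + B\<close>, whose derivative is \<open>(k \<kappa> - \<tau>) N\<close>; its component
  along \<open>B\<close> is \<open>1\<close>, so it does not vanish.\<close>

lemma helix_axis:
  assumes "\<And>s. s \<in> I \<Longrightarrow> \<tau> s = k * \<kappa> s"
  obtains a where "a \<noteq> 0" "\<And>s. s \<in> I \<Longrightarrow> a \<bullet> N s = 0"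
proof -
  have "((\<lambda>x. k *\<^sub>R T x + B x) has_vector_derivative 0) (at s within I)" if s: "s \<in> I" for s
  proof -
    have "((\<lambda>x. k *\<^sub>R T x + B x) has_vector_derivative k *\<^sub>R (\<kappa> s *\<^sub>R N s) + (- \<tau> s *\<^sub>R N s))
        (at s within I)"
      by (intro has_vector_derivative_add frenet_binormal s
          bounded_linear.has_vector_derivative[OF bounded_linear_scaleR_right] frenet_tangent)
    then show ?thesis
      by (simp add: assms[OF s])
  qed
  then obtain a where a: "\<And>x. x \<in> I \<Longrightarrow> k *\<^sub>R T x + B x = a"
    using has_vector_derivative_zero_constant[OF convex_interval] by blast
  obtain s where s: "s \<in> I"
    using interval(2) interior_subset by blast
  have "a \<bullet> B s = 1"
    by (simp add: a[OF s, symmetric] inner_add_left inner_binormal_self[OF s] binormal_orthogonal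
        inner_commute[of "T s" "B s"])
  then have "a \<noteq> 0"
    by auto
  moreover have "a \<bullet> N x = 0" if "x \<in> I" for x
    by (simp add: a[OF that, symmetric] inner_add_left binormal_orthogonal
        tangent_orthogonal_normal[OF that])
  ultimately show ?thesis
    using that by blast
qed

text \<open>With \<open>p = a \<bullet> T\<close> and \<open>q = a \<bullet> B\<close>, both constant, the derivative of \<open>a \<bullet> N = 0\<close> reads
  \<open>q \<tau> = p \<kappa>\<close>. The constant ratio is \<open>p / q\<close>; the degenerate case \<open>q = 0\<close> would make \<open>a\<close> zero.\<close>

lemma normal_on_great_circle_imp_helix:
  assumes "a \<noteq> 0" and aN: "\<And>s. s \<in> I \<Longrightarrow> a \<bullet> N s = 0"
  obtains k where "\<And>s. s \<in> I \<Longrightarrow> \<tau> s = k * \<kappa> s"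
proof -
  note inner_deriv = bounded_linear.has_vector_derivative[OF bounded_linear_inner_right[of a]]
  have "((\<lambda>x. a \<bullet> T x) has_vector_derivative 0) (at s within I)" if "s \<in> I" for s
    using inner_deriv[OF frenet_tangent[OF that]] aN[OF that] by simp
  then obtain p where p: "\<And>x. x \<in> I \<Longrightarrow> a \<bullet> T x = p"
    using has_vector_derivative_zero_constant[OF convex_interval] by blast
  have "((\<lambda>x. a \<bullet> B x) has_vector_derivative 0) (at s within I)" if "s \<in> I" for s
    using inner_deriv[OF frenet_binormal[OF that]] aN[OF that] by simp
  then obtain q where q: "\<And>x. x \<in> I \<Longrightarrow> a \<bullet> B x = q"
    using has_vector_derivative_zero_constant[OF convex_interval] by blast
  have eq: "\<tau> s * q = \<kappa> s * p" if s: "s \<in> I" for s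
  proof -
    have "((\<lambda>x. a \<bullet> N x) has_vector_derivative 0) (at s within I)"
      by (rule has_vector_derivative_transform[OF s aN]) auto
    then have "a \<bullet> (\<tau> s *\<^sub>R B s - \<kappa> s *\<^sub>R T s) = 0"
      using vderiv_eqI[OF interval s] inner_deriv[OF frenet_normal[OF s]] by metis
    then show ?thesis
      by (simp add: inner_diff_right p[OF s] q[OF s])
  qed
  have "q \<noteq> 0"
  proof
    assume "q = 0"
    obtain s where s: "s \<in> I"
      using interval(2) interior_subset by blast
    have "p = 0"
      using eq[OF s] \<open>q = 0\<close> curvature_pos[OF s] by simp
    then have "a = 0"
      using frame_expansion[OF s, of a] p[OF s] q[OF s] aN[OF s] \<open>q = 0\<close> by simp
    then show False
      using \<open>a \<noteq> 0\<close> by simp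
  qed
  then have "\<tau> s = (p / q) * \<kappa> s" if "s \<in> I" for s
    using eq[OF that] by (simp add: field_simps)
  then show ?thesis
    using that by blast
qed

lemma generalized_helix_iff: "generalized_helix I \<gamma> \<longleftrightarrow> (\<exists>k. \<forall>s\<in>I. \<tau> s = k * \<kappa> s)"
  using curvature_pos curvature_nonzero by (simp add: generalized_helix_def divide_eq_eq)

lemma traces_great_circle_normal_iff:
  "traces_great_circle I N \<longleftrightarrow> (\<exists>a. a \<noteq> 0 \<and> (\<forall>s\<in>I. a \<bullet> N s = 0))"
proof -
  have "(\<exists>C. great_circle C \<and> N ` I \<subseteq> C) \<longleftrightarrow>
      (\<exists>a. a \<noteq> 0 \<and> N ` I \<subseteq> {x \<in> sphere 0 1. a \<bullet> x = 0})"
    by (auto simp: great_circle_def)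
  also have "\<dots> \<longleftrightarrow> (\<exists>a. a \<noteq> 0 \<and> (\<forall>s\<in>I. a \<bullet> N s = 0))"
    by (auto simp: image_subset_iff)
  finally show ?thesis
    using normal_continuous normal_not_constant by (simp add: traces_great_circle_def)
qed

end

lemma traces_great_circle_cong:
  assumes "\<And>s. s \<in> I \<Longrightarrow> \<alpha> s = \<beta> s"
  shows "traces_great_circle I \<alpha> \<longleftrightarrow> traces_great_circle I \<beta>"
  using assms continuous_on_cong[of I I \<alpha> \<beta>]
  by (simp add: traces_great_circle_def constant_on_def image_subset_iff)

theorem theorem5:
  fixes \<gamma> :: "real \<Rightarrow> real^3" and I :: "real set" and c :: real
  assumes "is_interval I" and "interior I \<noteq> {}"
    and "unit_speed_curve I \<gamma>"
    and "\<forall>s\<in>I. curvature I \<gamma> s \<noteq> 0"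
    and "\<forall>s\<in>I. c - s > 0"
  shows "traces_great_circle I (unit_tangent I (involute I c \<gamma>)) \<longleftrightarrow> generalized_helix I \<gamma>"
proof -
  interpret frenet_curve I \<gamma>
    using assms(1-4) by unfold_locales auto
  have "traces_great_circle I (unit_tangent I (involute I c \<gamma>)) \<longleftrightarrow> traces_great_circle I N"
    using assms(5) by (intro traces_great_circle_cong unit_tangent_involute) auto
  also have "\<dots> \<longleftrightarrow> generalized_helix I \<gamma>"
    unfolding traces_great_circle_normal_iff generalized_helix_iff
    by (meson helix_axis normal_on_great_circle_imp_helix)
  finally show ?thesis .
qed

end
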